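(* Let $\mathcal{D}_{[n]}$ denote the poset $(\{1,\dots,n\},\mid)$, i.e. the set $[n]=\{1,\dots,n\}$ ordered by divisibility. Then, as $n\to\infty$, \[ \dim \mathcal{D}_{[n]} \le \bigl(4/\log 2 + o(1)\bigr)\,\frac{(\log n)^2\,\log\log\log n}{(\log\log n)^2}. \] Equivalently, for every $\varepsilon>0$ there is $n_0$ such that for all $n\ge n_0$, $\dim \mathcal{D}_{[n]} \le (4/\log 2+\varepsilon)\frac{(\log n)^2\log\log\log n}{(\log\log n)^2}$.
   Context: $\log$ denotes the natural logarithm. For a poset $P=(S,\le_P)$, a linear extension of $P$ is a linear order $\le_L$ on $S$ such that $a\le_P b$ implies $a\le_L b$. A realiser of $P$ is a set $\mathcal{L}$ of linear extensions of $P$ such that for every pair $(a,b)\in S^2$ with $a\not\ge_P b$ there is $L\in\mathcal{L}$ with $a\le_L b$. The dimension $\dim P$ is the minimum cardinality of a realiser of $P$ (equivalently, for countable $P$, the least $d$ such that $P$ embeds as a poset into $\mathbb{R}^d$ with the coordinatewise product order). *)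

theory Defs
  imports Complex_Main
begin

text \<open>
  A poset is given by a carrier \<open>S\<close> and a relation \<open>r\<close> with
  \<^term>\<open>partial_order_on S r\<close>, where \<open>(a, b) \<in> r\<close> means \<open>a \<le> b\<close>.
\<close>

definition linear_extension :: "'a set \<Rightarrow> 'a rel \<Rightarrow> 'a rel \<Rightarrow> bool" where
  "linear_extension S r l \<longleftrightarrow> linear_order_on S l \<and> r \<subseteq> l"

definition realiser :: "'a set \<Rightarrow> 'a rel \<Rightarrow> 'a rel set \<Rightarrow> bool" where
  "realiser S r \<L> \<longleftrightarrow>
     (\<forall>l\<in>\<L>. linear_extension S r l) \<and>
     (\<forall>a\<in>S. \<forall>b\<in>S. (b, a) \<notin> r \<longrightarrow> (\<exists>l\<in>\<L>. (a, b) \<in> l))"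

text \<open>
  Finiteness is required explicitly because \<^const>\<open>card\<close> is \<open>0\<close> on infinite sets. The value is
  meaningful only for posets having a finite realiser, which includes all finite posets (see
  \<open>finite_poset_dimension\<close> below).
\<close>

definition order_dimension :: "'a set \<Rightarrow> 'a rel \<Rightarrow> nat" where
  "order_dimension S r = (LEAST d. \<exists>\<L>. finite \<L> \<and> realiser S r \<L> \<and> card \<L> = d)"

definition divisibility_order :: "nat \<Rightarrow> nat rel" where
  "divisibility_order n = relation_of (dvd) {1..n}"

lemma partial_order_divisibility_order: "partial_order_on {1..n} (divisibility_order n)"
  unfolding divisibility_order_def
  by (rule partial_order_on_relation_ofI) (auto intro: dvd_trans dvd_antisym)

lemma finite_wf_linear_order:
  assumes "finite S" "wf p" "p \<subseteq> S \<times> S"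
  shows "\<exists>l. linear_order_on S l \<and> p \<subseteq> l"
  using assms
proof (induction S arbitrary: p rule: finite_psubset_induct)
  case (psubset S)
  show ?case
  proof (cases "S = {}")
    case True
    then show ?thesis
      using psubset.prems by (intro exI[of _ "{}"]) auto
  next
    case False
    then obtain m where m: "m \<in> S" "\<And>y. (y, m) \<in> p \<Longrightarrow> y \<notin> S"
      using psubset.prems(1) by (metis all_not_in_conv wfE_min)
    let ?p = "p \<inter> (S - {m}) \<times> (S - {m})"
    have "wf ?p"
      using psubset.prems(1) by (rule wf_subset) auto
    with psubset.IH[of "S - {m}" ?p] m(1)
    obtain l where l: "linear_order_on (S - {m}) l" "?p \<subseteq> l"
      by auto
    let ?l = "{m} \<times> S \<union> l"
    have l': "l \<subseteq> (S - {m}) \<times> (S - {m})" "refl_on (S - {m}) l" "trans l" "antisym l"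
        "total_on (S - {m}) l"
      using l(1) by (auto simp: order_on_defs)
    have "?l \<subseteq> S \<times> S" "refl_on S ?l"
      using l'(1,2) m(1) by (auto simp: refl_on_def)
    moreover have "trans ?l"
      using l'(1) l'(3) by (auto intro!: transI dest: transD)
    moreover have "antisym ?l"
      using l'(1) l'(4) by (auto intro!: antisymI dest: antisymD)
    moreover have "total_on S ?l"
      using l'(5) by (auto simp: total_on_def)
    ultimately have "linear_order_on S ?l"
      by (simp add: order_on_defs)
    moreover have "p \<subseteq> ?l"
      using psubset.prems(2) m(2) l(2) by auto
    ultimately show ?thesis
      by blast
  qed
qed

lemma linear_extension_exists:
  assumes "finite S" "partial_order_on S r" "a \<in> S" "b \<in> S" "(b, a) \<notin> r"
  shows "\<exists>l. linear_extension S r l \<and> (a, b) \<in> l"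
proof -
  have r: "r \<subseteq> S \<times> S" "refl_on S r" "trans r" "antisym r"
    using partial_order_onD[OF assms(2)] by auto
  have ab: "a \<noteq> b"
    using r(2) assms(3,5) by (auto dest: refl_onD)
  define p where "p = insert (a, b) (r - Id)"
  have tr: "trans (r - Id)"
    using r(3,4) by (rule trans_diff_Id)
  then have "acyclic (r - Id)"
    by (simp add: acyclic_irrefl irrefl_def)
  moreover have "(b, a) \<notin> (r - Id)\<^sup>*"
    using tr ab assms(5) by (auto simp: rtrancl_eq_or_trancl)
  ultimately have "acyclic p"
    unfolding p_def by simp
  moreover have sub: "p \<subseteq> S \<times> S"
    using r(1) assms(3,4) by (auto simp: p_def)
  then have "finite p"
    using assms(1) by (meson finite_SigmaI finite_subset)
  ultimately have "wf p"
    by (simp add: finite_acyclic_wf)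
  then obtain l where lin: "linear_order_on S l" and l: "p \<subseteq> l"
    using finite_wf_linear_order[OF assms(1) _ sub] by blast
  then have "refl_on S l"
    by (simp add: order_on_defs)
  with l r(1) have "r \<subseteq> l"
    by (auto simp: p_def dest: refl_onD)
  with lin l show ?thesis
    by (auto simp: linear_extension_def p_def)
qed

lemma finite_poset_dimension:
  assumes "finite S" "partial_order_on S r"
  shows "\<exists>\<L>. finite \<L> \<and> realiser S r \<L> \<and> card \<L> = order_dimension S r"
proof -
  let ?L = "{l. linear_extension S r l}"
  have "?L \<subseteq> Pow (S \<times> S)"
    by (auto simp: linear_extension_def order_on_defs)
  then have "finite ?L"
    using assms(1) by (meson finite_Pow_iff finite_SigmaI finite_subset)
  moreover have "realiser S r ?L"
    using linear_extension_exists[OF assms] by (simp add: realiser_def)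
  ultimately have "\<exists>d \<L>. finite \<L> \<and> realiser S r \<L> \<and> card \<L> = d"
    by blast
  then show ?thesis
    unfolding order_dimension_def by (rule LeastI_ex)
qed

end

theory Submission
  imports Defs "HOL-Algebra.Algebraic_Closure_Type" "HOL-Real_Asymp.Real_Asymp"
begin

text \<open>
  Let \<open>q\<close> be a power of two with \<open>n < q ^ q\<close>. Reading the base-\<open>q\<close> digits of a prime as coefficients
  over the field with \<open>q\<close> elements assigns to each prime \<open>r\<close> a polynomial \<open>f r\<close> of degree at most
  \<open>log r / log q\<close>. For each pair \<open>(x, y)\<close> of field elements, rank the primes with \<open>f p x = y\<close> above
  all others and otherwise by size, and take the lexicographic linear extension that compares the
  multiplicities of higher ranked primes first.

  These \<open>q\<^sup>2\<close> extensions form a realiser: after cancelling the gcd it suffices, for a prime \<open>p\<close>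
  not dividing \<open>a \<le> n\<close>, to rank \<open>p\<close> above all prime factors of \<open>a\<close>. With \<open>y = f p x\<close>, only a prime factor
  \<open>r > p\<close> with \<open>f r x = f p x\<close> can prevent this, and as \<open>f r - f p\<close> has at most \<open>log r / log q\<close>
  roots, at most \<open>log n / log q < q\<close> values of \<open>x\<close> are bad. Choosing \<open>q\<close> least gives a dimension of at most
  \<open>16 (log n / log log n)\<^sup>2\<close>, so the factor \<open>log log log n\<close> in the theorem absorbs the constant.
\<close>

section \<open>Finite fields of characteristic two\<close>

text \<open>Over an algebraically closed field \<open>p\<close> splits into linear factors, and a
  repeated factor would give a common root with \<open>pderiv p\<close>; hence the multiset of roots
  has no repetitions.\<close>

lemma card_roots_separable:
  fixes p :: "'a::alg_closed_field poly"
  assumes sep: "\<And>x. poly p x = 0 \<Longrightarrow> poly (pderiv p) x \<noteq> 0"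
  shows "card {x. poly p x = 0} = degree p"
proof -
  have "p \<noteq> 0"
    using sep by force
  then obtain A where A: "size A = degree p" "p = smult (lead_coeff p) (\<Prod>x\<in>#A. [:-x, 1:])"
    using alg_closed_imp_factorization by blast
  have count: "count A x = 1" if "x \<in># A" for x
  proof (rule ccontr)
    assume "count A x \<noteq> 1"
    moreover have "count A x > 0"
      using that by simp
    ultimately have "count A x > 1"
      by linarith
    moreover obtain C where C: "A = add_mset x C"
      using multi_member_split[OF \<open>x \<in># A\<close>] by blast
    ultimately have "x \<in># C"
      by simp
    then obtain B where "C = add_mset x B"
      using multi_member_split[of x C] by blast
    with C have B: "A = add_mset x (add_mset x B)"
      by simp
    define r where "r = smult (lead_coeff p) (\<Prod>x\<in>#B. [:-x, 1:])"
    have p: "p = [:-x, 1:] * ([:-x, 1:] * r)"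
      using A(2) unfolding B r_def by (simp add: mult.assoc del: mult_pCons_left)
    have "poly p x = 0"
      by (subst p) simp
    moreover have "poly (pderiv p) x = 0"
      by (subst p) (simp add: pderiv_mult del: mult_pCons_left)
    ultimately show False
      using sep by blast
  qed
  have "poly p x = lead_coeff p * (\<Prod>y\<in>#A. x - y)" for x
    by (subst A(2)) (simp add: poly_prod_mset image_mset.compositionality o_def)
  then have "{x. poly p x = 0} = set_mset A"
    using \<open>p \<noteq> 0\<close> by (auto simp: prod_mset_zero_iff)
  then show ?thesis
    using A(1) count by (simp add: size_multiset_overloaded_eq)
qed

text \<open>With \<open>q = CHAR('a) ^ e\<close>, the polynomial \<open>X ^ q - X\<close> has
  derivative \<open>-1\<close>, so its roots are simple.\<close>

lemma card_frobenius_fixed: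
  fixes e :: nat
  assumes "prime CHAR('a::alg_closed_field)" "e > 0"
  shows "card {x::'a. x ^ (CHAR('a) ^ e) = x} = CHAR('a) ^ e"
proof -
  define q where "q = CHAR('a) ^ e"
  define p :: "'a poly" where "p = monom 1 q + [:0, -1:]"
  have q: "q > 1"
    using assms prime_gt_1_nat by (simp add: q_def one_less_power del: One_nat_def)
  have "of_nat q = (0::'a)"
    using assms(2) by (simp add: q_def)
  then have "pderiv p = -1"
    by (simp add: p_def pderiv_add pderiv_monom pderiv_pCons one_pCons)
  moreover have "degree p = q"
    unfolding p_def using q by (subst degree_add_eq_left) (auto simp: degree_monom_eq)
  ultimately have "card {x. poly p x = 0} = q"
    using card_roots_separable[of p] by simp
  then show ?thesis
    by (simp add: p_def poly_monom q_def)
qed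

lemma CHAR_gf2: "CHAR(gf2) = 2"
proof -
  have "of_nat 2 = (0::gf2)"
    unfolding numeral_2_eq_2 of_nat_Suc of_nat_0 by transfer auto
  then have "CHAR(gf2) dvd 2"
    by (simp only: of_nat_eq_0_iff_char_dvd)
  then show ?thesis
    using CHAR_not_1'[where 'a = gf2] by (metis One_nat_def prime_nat_iff two_is_prime_nat)
qed

section \<open>The digit code\<close>

context
  fixes q :: nat and g :: "nat \<Rightarrow> 'a::idom" and K :: "'a set"
  assumes q: "q > 1" and g: "bij_betw g {..<q} K" and g0: "g 0 = 0"
begin

function digit_poly :: "nat \<Rightarrow> 'a poly" where
  "digit_poly m = (if m = 0 then 0 else pCons (g (m mod q)) (digit_poly (m div q)))"
  by auto
termination
  using q by (relation "measure id") auto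

declare digit_poly.simps [simp del]

lemma digit_poly_0: "digit_poly 0 = 0"
  by (simp add: digit_poly.simps)

lemma digit_poly_pos: "m > 0 \<Longrightarrow> digit_poly m = pCons (g (m mod q)) (digit_poly (m div q))"
  by (subst digit_poly.simps) simp

text \<open>\<open>g 0 = 0\<close> extends the recursion to \<open>0\<close>, so injectivity needs
  no separate treatment of a single zero argument.\<close>

lemma digit_poly_rec: "digit_poly m = pCons (g (m mod q)) (digit_poly (m div q))"
  by (cases "m = 0") (auto simp: digit_poly_0 digit_poly_pos g0)

lemma digit_poly_inject: "digit_poly m = digit_poly k \<Longrightarrow> m = k"
proof (induction "m + k" arbitrary: m k rule: less_induct)
  case less
  show ?case
  proof (cases "m + k = 0")
    case False
    from less.prems have eq: "g (m mod q) = g (k mod q)" "digit_poly (m div q) = digit_poly (k div q)"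
      using digit_poly_rec[of m] digit_poly_rec[of k] by auto
    have "m mod q = k mod q"
      using eq(1) q bij_betw_imp_inj_on[OF g] by (auto dest: inj_onD)
    moreover have "m div q + k div q < m + k"
      using False q
      by (metis add_gr_0 add_less_le_mono add_le_less_mono div_le_dividend div_less_dividend not_gr_zero)
    with less.hyps eq(2) have "m div q = k div q"
      by blast
    ultimately show ?thesis
      by (metis div_mult_mod_eq)
  qed auto
qed

lemma degree_digit_poly: "m > 0 \<Longrightarrow> q ^ degree (digit_poly m) \<le> m"
proof (induction m rule: less_induct)
  case (less m)
  show ?case
  proof (cases "m div q = 0")
    case True
    then show ?thesis
      using less.prems by (simp add: digit_poly_pos digit_poly_0)
  next
    case False
    have "degree (digit_poly m) \<le> Suc (degree (digit_poly (m div q)))"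
      using less.prems by (simp add: digit_poly_pos degree_pCons_le)
    then have "q ^ degree (digit_poly m) \<le> q * q ^ degree (digit_poly (m div q))"
      using q power_increasing[of "degree (digit_poly m)" _ q] by fastforce
    also have "\<dots> \<le> q * (m div q)"
      using less False q by (intro mult_left_mono less.IH) auto
    also have "\<dots> \<le> m"
      by simp
    finally show ?thesis .
  qed
qed

text \<open>The nonzero difference has at most as many roots as its degree, hence at most the
  base-\<open>q\<close> logarithm of \<open>k\<close>. The exponential form lets these bounds be
  multiplied over primes.\<close>

lemma card_digit_poly_agree:
  assumes "0 < m" "m < k"
  shows "q ^ card {x. poly (digit_poly k) x = poly (digit_poly m) x} \<le> k"
proof -
  let ?d = "digit_poly k - digit_poly m"
  have "?d \<noteq> 0"
    using digit_poly_inject assms(2) by fastforce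
  then have "card {x. poly ?d x = 0} \<le> degree ?d"
    by (rule card_poly_roots_bound)
  also have "\<dots> \<le> max (degree (digit_poly k)) (degree (digit_poly m))"
    by (rule degree_diff_le_max)
  finally have "q ^ card {x. poly ?d x = 0} \<le> q ^ max (degree (digit_poly k)) (degree (digit_poly m))"
    using q by (intro power_increasing) auto
  also have "\<dots> \<le> k"
    using degree_digit_poly[of k] degree_digit_poly[of m] assms by (auto simp: max_def)
  finally show ?thesis
    by simp
qed

lemma finite_digit_poly_agree:
  assumes "m \<noteq> k"
  shows "finite {x. poly (digit_poly k) x = poly (digit_poly m) x}"
proof -
  have "digit_poly k - digit_poly m \<noteq> 0"
    using digit_poly_inject assms by fastforce
  then have "finite {x. poly (digit_poly k - digit_poly m) x = 0}"
    by (rule poly_roots_finite)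
  then show ?thesis
    by simp
qed

text \<open>Keeps the values inside \<open>K\<close>, so that pairs from \<open>K \<times> K\<close>
  suffice as indices.\<close>

lemma poly_digit_poly_closed:
  assumes "0 \<in> K" "\<And>x y. x \<in> K \<Longrightarrow> y \<in> K \<Longrightarrow> x + y \<in> K" "\<And>x y. x \<in> K \<Longrightarrow> y \<in> K \<Longrightarrow> x * y \<in> K"
    and "x \<in> K"
  shows "poly (digit_poly m) x \<in> K"
proof (induction m rule: less_induct)
  case (less m)
  show ?case
  proof (cases "m = 0")
    case False
    have "g (m mod q) \<in> K"
      using q bij_betwE[OF g] by auto
    moreover have "poly (digit_poly (m div q)) x \<in> K"
      using less False q by simp
    ultimately show ?thesis
      using False assms by (simp add: digit_poly_pos)
  qed (simp add: digit_poly_0 assms)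
qed

text \<open>Multiplying the agreement bounds over the prime factors above \<open>p\<close> shows
  that \<open>q\<close> to the number of bad points is at most \<open>a\<close>, hence below
  \<open>q ^ q\<close>; so some point of \<open>K\<close> is good.\<close>

lemma digit_code_separates:
  assumes "0 < p" "\<not> p dvd a" "0 < a" "a < q ^ q"
  shows "\<exists>x\<in>K. \<forall>r\<in>prime_factors a. p < r \<longrightarrow> poly (digit_poly r) x \<noteq> poly (digit_poly p) x"
proof -
  let ?R = "{r \<in> prime_factors a. p < r}"
  let ?B = "\<lambda>r. {x. poly (digit_poly r) x = poly (digit_poly p) x}"
  have "q ^ card (\<Union>r\<in>?R. ?B r) \<le> q ^ (\<Sum>r\<in>?R. card (?B r))"
    using q by (intro power_increasing card_UN_le) auto
  also have "\<dots> = (\<Prod>r\<in>?R. q ^ card (?B r))"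
    by (rule power_sum)
  also have "\<dots> \<le> \<Prod>?R"
    using assms(1) by (intro prod_mono) (auto intro: card_digit_poly_agree)
  also have "\<dots> \<le> \<Prod>(prime_factors a)"
    by (intro dvd_imp_le prod_dvd_prod_subset prod_pos) (auto dest: in_prime_factors_imp_prime prime_gt_0_nat)
  also have "\<dots> \<le> (\<Prod>r\<in>prime_factors a. r ^ multiplicity r a)"
    by (intro prod_mono conjI self_le_power)
      (auto simp: prime_factors_multiplicity intro: Suc_leI prime_gt_0_nat)
  also have "\<dots> = a"
    using assms(3) prod_prime_factors[of a] by simp
  finally have "q ^ card (\<Union>r\<in>?R. ?B r) < q ^ q"
    using assms(4) by linarith
  then have "card (\<Union>r\<in>?R. ?B r) < card K"
    using q bij_betw_same_card[OF g] by simp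
  moreover have "finite (\<Union>r\<in>?R. ?B r)"
    by (intro finite_UN_I) (auto intro: finite_digit_poly_agree)
  ultimately have "\<not> K \<subseteq> (\<Union>r\<in>?R. ?B r)"
    by (meson card_mono not_le)
  then show ?thesis
    by auto
qed

end

section \<open>Linear extensions from rankings of the primes\<close>

lemma order_dimension_le:
  assumes "finite I" "\<And>i. i \<in> I \<Longrightarrow> linear_extension S r (l i)"
    and "\<And>a b. a \<in> S \<Longrightarrow> b \<in> S \<Longrightarrow> (b, a) \<notin> r \<Longrightarrow> \<exists>i\<in>I. (a, b) \<in> l i"
  shows "order_dimension S r \<le> card I"
proof -
  have "realiser S r (l ` I)"
    using assms(2,3) by (simp add: realiser_def)
  then have "order_dimension S r \<le> card (l ` I)"
    unfolding order_dimension_def using assms(1) by (intro Least_le) auto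
  also have "\<dots> \<le> card I"
    using assms(1) by (rule card_image_le)
  finally show ?thesis .
qed

text \<open>Strict weight comparison is well-founded and contains the strict part of
  \<open>r\<close>; any linear order extending it works, with ties broken arbitrarily.\<close>

lemma linear_extension_of_weight:
  fixes W :: "'a \<Rightarrow> nat"
  assumes "finite S" "partial_order_on S r" "\<And>a b. (a, b) \<in> r \<Longrightarrow> a \<noteq> b \<Longrightarrow> W a < W b"
  shows "\<exists>l. linear_extension S r l \<and> (\<forall>a\<in>S. \<forall>b\<in>S. W a < W b \<longrightarrow> (a, b) \<in> l)"
proof -
  let ?p = "{(a, b). a \<in> S \<and> b \<in> S \<and> W a < W b}"
  have "wf ?p"
    by (rule wf_subset[OF wf_measure[of W]]) auto
  then obtain l where l: "linear_order_on S l" "?p \<subseteq> l"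
    using finite_wf_linear_order[OF assms(1), of ?p] by auto
  have "refl_on S l"
    using l(1) by (simp add: order_on_defs)
  moreover have "r \<subseteq> S \<times> S"
    using partial_order_onD[OF assms(2)] by auto
  ultimately have "r \<subseteq> l"
    using l(2) assms(3) by (force dest: refl_onD)
  with l show ?thesis
    by (auto simp: linear_extension_def)
qed

definition prime_weight :: "(nat \<Rightarrow> nat) \<Rightarrow> nat \<Rightarrow> nat" where
  "prime_weight w m = (\<Sum>p\<in>#prime_factorization m. w p)"

lemma prime_weight_mult:
  "a > 0 \<Longrightarrow> b > 0 \<Longrightarrow> prime_weight w (a * b) = prime_weight w a + prime_weight w b"
  by (simp add: prime_weight_def prime_factorization_mult)

lemma prime_weight_ge:
  assumes "prime p" "p dvd m" "m > 0"
  shows "w p \<le> prime_weight w m"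
proof -
  have "p \<in># prime_factorization m"
    using assms by (simp add: prime_factors_dvd)
  then obtain B where "prime_factorization m = add_mset p B"
    by (metis insert_DiffM)
  then show ?thesis
    by (simp add: prime_weight_def)
qed

lemma prime_weight_less:
  assumes "\<And>p. w p > 0" "a dvd b" "a \<noteq> b" "b > 0"
  shows "prime_weight w a < prime_weight w b"
proof -
  obtain c where c: "b = a * c"
    using assms(2) by blast
  with assms(3) have "c \<noteq> 1"
    by auto
  then obtain p where p: "prime p" "p dvd c"
    using prime_factor_nat by blast
  then have "0 < prime_weight w c"
    using prime_weight_ge[of p c w] assms(1)[of p] assms(4) c by auto
  then show ?thesis
    using assms(4) c by (simp add: prime_weight_mult)
qed

text \<open>All prime factors are at least 2, so their product is at least their number. This
  justifies the base \<open>Suc n\<close> of the weights below.\<close>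

lemma size_prime_factorization_le:
  assumes "m > 0"
  shows "size (prime_factorization m) \<le> (m::nat)"
proof -
  have "size M \<le> prod_mset M" if "\<forall>x\<in>#M. 2 \<le> x" for M :: "nat multiset"
    using that
  proof (induction M)
    case (add x M)
    have "1 \<le> prod_mset M"
      using add.prems by (auto simp: Suc_le_eq prod_mset_zero_iff simp flip: neq0_conv)
    then have "size (add_mset x M) \<le> 2 * prod_mset M"
      using add by simp
    also have "\<dots> \<le> x * prod_mset M"
      using add.prems by (intro mult_right_mono) auto
    finally show ?case
      by simp
  qed simp
  from this[of "prime_factorization m"] show ?thesis
    using assms prime_ge_2_nat by (auto simp: prod_mset_prime_factorization_nat dest: in_prime_factors_imp_prime)
qed

text \<open>
  The weights are powers of a base exceeding the number of prime factors of any element, so that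
  comparing total weights amounts to comparing multiplicities lexicographically, starting at the
  prime of highest rank.
\<close>

lemma order_dimension_divisibility_le:
  fixes rank :: "'i \<Rightarrow> nat \<Rightarrow> nat"
  assumes "finite I"
    and rank: "\<And>p a. prime p \<Longrightarrow> p \<le> n \<Longrightarrow> 0 < a \<Longrightarrow> a \<le> n \<Longrightarrow> \<not> p dvd a \<Longrightarrow>
      \<exists>i\<in>I. \<forall>r\<in>prime_factors a. rank i r < rank i p"
  shows "order_dimension {1..n} (divisibility_order n) \<le> card I"
proof -
  define W where "W = (\<lambda>i. prime_weight (\<lambda>p. Suc n ^ rank i p))"
  have "\<exists>l. linear_extension {1..n} (divisibility_order n) l \<and>
      (\<forall>a\<in>{1..n}. \<forall>b\<in>{1..n}. W i a < W i b \<longrightarrow> (a, b) \<in> l)" for i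
    unfolding W_def
    by (intro linear_extension_of_weight partial_order_divisibility_order prime_weight_less)
      (auto simp: divisibility_order_def relation_of_def)
  then obtain l where l: "\<And>i. linear_extension {1..n} (divisibility_order n) (l i)"
      "\<And>i a b. a \<in> {1..n} \<Longrightarrow> b \<in> {1..n} \<Longrightarrow> W i a < W i b \<Longrightarrow> (a, b) \<in> l i"
    by metis
  show ?thesis
  proof (rule order_dimension_le[where l = l])
    fix a b assume ab: "a \<in> {1..n}" "b \<in> {1..n}" "(b, a) \<notin> divisibility_order n"
    then have ndvd: "\<not> b dvd a"
      by (auto simp: divisibility_order_def relation_of_def)
    \<comment> \<open>Weights are additive, so the common factor \<open>d\<close> cancels and the
      coprime cofactors can be compared instead.\<close>
    define d where "d = gcd a b"
    obtain a' b' where *: "a = a' * d" "b = b' * d" "coprime a' b'"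
      using ab gcd_coprime_exists[of a b] unfolding d_def by auto
    have pos: "a' > 0" "b' > 0" "d > 0"
      using ab * by (auto intro!: gr0I)
    have "b' \<noteq> 1"
      using ndvd * by auto
    then obtain p where p: "prime p" "p dvd b'"
      using prime_factor_nat by blast
    have "\<not> p dvd a'"
      using p *(3) by (meson coprime_common_divisor not_prime_unit)
    moreover have "p \<le> b'" "b' \<le> b" "a' \<le> a"
      using p pos * by (auto intro: dvd_imp_le)
    then have le: "p \<le> n" "a' \<le> n"
      using ab by auto
    ultimately obtain i where i: "i \<in> I" "\<forall>r\<in>prime_factors a'. rank i r < rank i p"
      using rank[of p a'] p pos by blast
    \<comment> \<open>The extra factor \<open>Suc n\<close> raises each exponent by one, to at most
      \<open>rank i p\<close>; the at most \<open>n\<close> terms then stay below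
      \<open>Suc n * Suc n ^ rank i p\<close>.\<close>
    have "Suc n * W i a' = (\<Sum>r\<in>#prime_factorization a'. Suc n ^ Suc (rank i r))"
      by (simp add: W_def prime_weight_def sum_mset_distrib_left)
    also have "\<dots> \<le> (\<Sum>r\<in>#prime_factorization a'. Suc n ^ rank i p)"
      using i(2) by (intro sum_mset_mono power_increasing) auto
    also have "\<dots> = size (prime_factorization a') * Suc n ^ rank i p"
      by (simp add: sum_mset_constant)
    also have "\<dots> \<le> n * Suc n ^ rank i p"
      using size_prime_factorization_le[OF pos(1)] le(2) by (intro mult_right_mono) auto
    also have "\<dots> < Suc n * Suc n ^ rank i p"
      by simp
    finally have "W i a' < Suc n ^ rank i p"
      by (simp only: mult_less_cancel1)
    also have "\<dots> \<le> W i b'"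
      unfolding W_def using prime_weight_ge[OF p pos(2), of "\<lambda>p. Suc n ^ rank i p"] by simp
    finally have "W i a < W i b"
      unfolding *(1,2) W_def using pos by (simp add: prime_weight_mult)
    then show "\<exists>i\<in>I. (a, b) \<in> l i"
      using l(2) ab i(1) by blast
  qed (use assms(1) l(1) in auto)
qed

text \<open>\<open>K\<close> plays the finite field, given as a subset of a domain so that its order
  can vary within one type.\<close>

lemma order_dimension_divisibility_le_square:
  fixes K :: "'a::idom set"
  assumes "0 \<in> K" "\<And>x y. x \<in> K \<Longrightarrow> y \<in> K \<Longrightarrow> x + y \<in> K" "\<And>x y. x \<in> K \<Longrightarrow> y \<in> K \<Longrightarrow> x * y \<in> K"
    and q: "card K = q" "q > 1" and n: "n < q ^ q"
  shows "order_dimension {1..n} (divisibility_order n) \<le> q\<^sup>2"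
proof -
  have fin: "finite K"
    using q by (intro card_ge_0_finite) simp
  have "card (K - {0}) = card {1..<q}"
    using assms(1) fin q by simp
  then obtain h where h: "bij_betw h {1..<q} (K - {0})"
    using fin by (metis finite_Diff finite_atLeastLessThan finite_same_card_bij)
  define g where "g = (\<lambda>i. if i = 0 then 0 else h i)"
  have "bij_betw g {1..<q} (K - {0})"
    by (rule bij_betw_cong[THEN iffD1, OF _ h]) (auto simp: g_def)
  then have "bij_betw g ({1..<q} \<union> {0}) ((K - {0}) \<union> {0})"
    by (rule bij_betw_combine) (auto simp: g_def bij_betw_def)
  moreover have "{1..<q} \<union> {0} = {..<q}" "(K - {0}) \<union> {0} = K"
    using assms(1) q by auto
  ultimately have g: "bij_betw g {..<q} K" "g 0 = 0"
    by (auto simp: g_def)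
  define f where "f = digit_poly q g"
  \<comment> \<open>The shift by \<open>n\<close> places agreeing primes above all other primes up
    to \<open>n\<close>, while size still decides within each group.\<close>
  define rank where "rank = (\<lambda>(x, y) p. if poly (f p) x = y then n + p else p)"
  have "order_dimension {1..n} (divisibility_order n) \<le> card (K \<times> K)"
  proof (rule order_dimension_divisibility_le[where rank = rank])
    fix p a :: nat
    assume pa: "prime p" "p \<le> n" "0 < a" "a \<le> n" "\<not> p dvd a"
    then obtain x where x: "x \<in> K" "\<forall>r\<in>prime_factors a. p < r \<longrightarrow> poly (f r) x \<noteq> poly (f p) x"
      using digit_code_separates[OF q(2) g, of p a] n prime_gt_0_nat unfolding f_def by auto
    \<comment> \<open>A smaller \<open>r\<close> ranks below \<open>p\<close> whether shifted or
      not; a larger one is unshifted by the choice of \<open>x\<close>, and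
      \<open>r \<le> n < n + p\<close>.\<close>
    have "rank (x, poly (f p) x) r < rank (x, poly (f p) x) p" if "r \<in> prime_factors a" for r
    proof -
      have "r dvd a" "r \<le> n" "r \<noteq> p"
        using that pa by (auto simp: in_prime_factors_iff dest: dvd_imp_le)
      then show ?thesis
        using x(2) that prime_gt_0_nat[OF pa(1)] by (cases "p < r") (auto simp: rank_def)
    qed
    moreover have "poly (f p) x \<in> K"
      unfolding f_def using poly_digit_poly_closed[OF q(2) g assms(1-3) x(1)] by simp
    ultimately show "\<exists>i\<in>K \<times> K. \<forall>r\<in>prime_factors a. rank i r < rank i p"
      using x(1) by blast
  qed (use fin in auto)
  then show ?thesis
    by (simp add: card_cartesian_product q power2_eq_square)
qed

text \<open>The fixed points of the \<open>e\<close>-th Frobenius iterate in the closure of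
  \<open>gf2\<close> serve as the field; closure under addition is the freshman's dream.\<close>

lemma order_dimension_divisibility_le_power_two:
  assumes "e > 0" "n < (2 ^ e) ^ (2 ^ e)"
  shows "order_dimension {1..n} (divisibility_order n) \<le> (2 ^ e)\<^sup>2"
proof -
  let ?K = "{x::gf2 alg_closure. x ^ (2 ^ e) = x}"
  have CHAR: "CHAR(gf2 alg_closure) = 2"
    by (simp add: CHAR_gf2)
  show ?thesis
  proof (rule order_dimension_divisibility_le_square[of ?K])
    show "card ?K = 2 ^ e"
      using card_frobenius_fixed[where 'a = "gf2 alg_closure", of e] assms(1)
      unfolding CHAR by simp
    show "x + y \<in> ?K" if "x \<in> ?K" "y \<in> ?K" for x y
      using that freshmans_dream'[where 'a = "gf2 alg_closure", of "2 ^ e" e x y]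
      unfolding CHAR by simp
  qed (use assms one_less_power[of "2::nat" e] in \<open>auto simp: power_mult_distrib\<close>)
qed

section \<open>Asymptotics\<close>

text \<open>Split at \<open>sqrt L\<close>: below it the claim follows from
  \<open>ln L \<le> 2 * sqrt L\<close>, above it from \<open>ln s \<ge> ln L / 2\<close>.\<close>

lemma le_of_mult_ln_le:
  fixes s L :: real
  assumes "s \<ge> 1" "s * ln s \<le> L" "L > 1"
  shows "s \<le> 2 * L / ln L"
proof (cases "s \<le> sqrt L")
  case True
  have "ln L = 2 * ln (sqrt L)"
    using assms(3) by (simp add: ln_sqrt)
  also have "\<dots> \<le> 2 * sqrt L"
    using assms(3) ln_less_self[of "sqrt L"] by (simp add: less_imp_le)
  finally have "sqrt L * ln L \<le> sqrt L * (2 * sqrt L)"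
    by (rule mult_left_mono) (use assms(3) in simp)
  also have "\<dots> = 2 * L"
    using assms(3) by simp
  finally have "sqrt L * ln L \<le> 2 * L" .
  then have "sqrt L \<le> 2 * L / ln L"
    using assms(3) by (simp add: field_simps)
  with True show ?thesis
    by simp
next
  case False
  have "ln L / 2 = ln (sqrt L)"
    using assms(3) by (simp add: ln_sqrt)
  also have "\<dots> \<le> ln s"
    using False assms by (intro ln_mono) auto
  finally have "s * (ln L / 2) \<le> s * ln s"
    using assms(1) by (intro mult_left_mono) auto
  then have "s * (ln L / 2) \<le> L"
    using assms(2) by linarith
  then show ?thesis
    using assms(3) by (simp add: field_simps)
qed

text \<open>By minimality of \<open>e\<close>, the halved order \<open>s = 2 ^ (e - 1)\<close> has
  \<open>s ^ s \<le> n\<close>, so \<open>s \<le> 2 * ln n / ln (ln n)\<close>. Squaring the full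
  order \<open>2 * s\<close> yields the 16.\<close>

lemma order_dimension_divisibility_bound:
  assumes "ln (real n) > 1"
  shows "real (order_dimension {1..n} (divisibility_order n))
    \<le> 16 * ((ln (real n))\<^sup>2 / (ln (ln (real n)))\<^sup>2)"
proof -
  have n: "n \<ge> 1"
    using assms by (cases n) auto
  let ?P = "\<lambda>e::nat. n < (2 ^ e) ^ (2 ^ e)"
  have "n < 2 ^ n"
    by (rule less_exp)
  also have "(2::nat) ^ n \<le> (2 ^ n) ^ (2 ^ n)"
    by (rule self_le_power) auto
  finally have ex: "?P n" .
  define e where "e = (LEAST e. ?P e)"
  have e: "?P e"
    unfolding e_def using ex by (rule LeastI)
  have "e \<noteq> 0"
    using e n by (metis less_one not_less power_0 power_one)
  then obtain d where d: "e = Suc d"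
    using not0_implies_Suc by blast
  have "\<not> ?P d"
    using not_less_Least[of d ?P] d unfolding e_def by simp
  then have "real ((2 ^ d) ^ (2 ^ d)) \<le> real n"
    by (intro of_nat_mono) simp
  then have "ln (real ((2 ^ d) ^ (2 ^ d))) \<le> ln (real n)"
    by (intro ln_mono) auto
  moreover define s :: real where "s = 2 ^ d"
  ultimately have "s * ln s \<le> ln (real n)"
    by (simp add: ln_realpow)
  then have s: "s \<le> 2 * ln (real n) / ln (ln (real n))"
    using assms by (intro le_of_mult_ln_le) (auto simp: s_def)
  have "order_dimension {1..n} (divisibility_order n) \<le> (2 ^ e)\<^sup>2"
    using order_dimension_divisibility_le_power_two[of e n] e d by simp
  then have "real (order_dimension {1..n} (divisibility_order n)) \<le> real ((2 ^ e)\<^sup>2)"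
    by (rule of_nat_mono)
  also have "\<dots> = 4 * s\<^sup>2"
    by (simp add: s_def d power_mult_distrib)
  also have "\<dots> \<le> 4 * (2 * ln (real n) / ln (ln (real n)))\<^sup>2"
    using s by (intro mult_left_mono power_mono) (auto simp: s_def)
  also have "\<dots> = 16 * ((ln (real n))\<^sup>2 / (ln (ln (real n)))\<^sup>2)"
    by (simp add: power_mult_distrib power_divide)
  finally show ?thesis .
qed

theorem theorem1p2:
  shows "\<forall>\<epsilon>::real. \<epsilon> > 0 \<longrightarrow> (\<exists>n0::nat. \<forall>n\<ge>n0.
    real (order_dimension {1..n} (divisibility_order n))
      \<le> (4 / ln 2 + \<epsilon>) * ((ln (real n))\<^sup>2 * ln (ln (ln (real n))) / (ln (ln (real n)))\<^sup>2))"
proof (intro allI impI)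
  fix \<epsilon> :: real
  assume "\<epsilon> > 0"
  \<comment> \<open>The constant 16 is split as 4 times 4: one factor is at most
    \<open>4 / ln 2\<close>, the other is absorbed by the triple logarithm once that reaches
    4.\<close>
  have "\<forall>\<^sub>F n in at_top. ln (real n) > 1 \<and> ln (ln (ln (real n))) \<ge> 4"
    by (intro eventually_conj; real_asymp)
  then obtain n0 where n0: "\<And>n. n \<ge> n0 \<Longrightarrow> ln (real n) > 1 \<and> ln (ln (ln (real n))) \<ge> 4"
    by (auto simp: eventually_at_top_linorder)
  have "4 \<le> 4 / ln (2::real)"
    using ln_2_less_1 by (simp add: field_simps)
  with \<open>\<epsilon> > 0\<close> have c: "4 \<le> 4 / ln 2 + \<epsilon>"
    by linarith
  show "\<exists>n0::nat. \<forall>n\<ge>n0. real (order_dimension {1..n} (divisibility_order n))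
      \<le> (4 / ln 2 + \<epsilon>) * ((ln (real n))\<^sup>2 * ln (ln (ln (real n))) / (ln (ln (real n)))\<^sup>2)"
  proof (intro exI[of _ n0] allI impI)
    fix n assume "n \<ge> n0"
    note n = n0[OF this]
    let ?Q = "(ln (real n))\<^sup>2 / (ln (ln (real n)))\<^sup>2"
    have "real (order_dimension {1..n} (divisibility_order n)) \<le> (4 * 4) * ?Q"
      using order_dimension_divisibility_bound n by simp
    also have "\<dots> \<le> ((4 / ln 2 + \<epsilon>) * ln (ln (ln (real n)))) * ?Q"
      using n c by (intro mult_right_mono mult_mono) auto
    finally show "real (order_dimension {1..n} (divisibility_order n))
      \<le> (4 / ln 2 + \<epsilon>) * ((ln (real n))\<^sup>2 * ln (ln (ln (real n))) / (ln (ln (real n)))\<^sup>2)"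
      by (simp add: mult_ac)
  qed
qed

end
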